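(* Let $\sigma$ be an index-one saddle of $U$ with $H_\sigma=\nabla^2U(\sigma)$ having eigenvalues $-\lambda_\sigma<0$ and $\lambda_2^\sigma,\dots,\lambda_d^\sigma>0$, and let $L,\gamma,\varepsilon>0$. In an eigenbasis of $H_\sigma$, the full $3d\times3d$ matrix of the deterministic drift $(p,\,-L^{-1}\nabla U(\theta)+\gamma r,\,-\gamma p-\gamma r)$ linearized at $(\sigma,0,0)$ block-diagonalizes into one unstable triple $$\mathsf A_\sigma=\begin{pmatrix}0&1&0\\ \lambda_\sigma/L&0&\gamma\\ 0&-\gamma&-\gamma\end{pmatrix}$$ (with the single positive eigenvalue $\mu_\sigma$) and $d-1$ stable normal triples, acting on $(q_i,v_i,w_i)$, $i\ge2$, whose spectra lie in the open left half-plane. Lifting the orthogonal diagonalization of $H_\sigma$ to phase space, $q=O_\sigma^\top(\theta-\sigma)$, $v=O_\sigma^\top p$, $w=O_\sigma^\top r$, leaves $|p|^2+|r|^2$ and the diffusion operator $\Delta_r$ invariant, so the linearized saddle generator decomposes accordingly over the triples, and the quadratic Hamiltonian becomes $$H_\sigma^{\rm quad}=U(\sigma)-\frac{\lambda_\sigma}2q_1^2+\frac12\sum_{i=2}^d\lambda_i^\sigma q_i^2+\frac L2|v|^2+\frac L2|w|^2,\qquad -\det H_\sigma=\lambda_\sigma\prod_{i=2}^d\lambda_i^\sigma.$$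
   Context: $U\in C^\infty(\mathbb R^d)$. $O_\sigma$ is an orthogonal matrix whose columns are eigenvectors of $H_\sigma$, the first column $e_\sigma$ being for the eigenvalue $-\lambda_\sigma$ and the $i$-th for $\lambda_i^\sigma$. $\mu_\sigma$ is the unique positive root of $\mu^3+\gamma\mu^2+(\gamma^2-\lambda_\sigma/L)\mu-\gamma\lambda_\sigma/L=0$ (the characteristic polynomial of $\mathsf A_\sigma$). The linearized saddle generator is $\mathcal L_{\sigma,\varepsilon}=b_\sigma^{\rm lin}\cdot\nabla+(\gamma\varepsilon/L)\Delta_r$, where $b_\sigma^{\rm lin}(\theta,p,r)=(p,\,-L^{-1}H_\sigma(\theta-\sigma)+\gamma r,\,-\gamma p-\gamma r)$. The quadratic Hamiltonian $H_\sigma^{\rm quad}$ is the second-order Taylor polynomial at $(\sigma,0,0)$ of $H(\theta,p,r)=U(\theta)+\frac L2|p|^2+\frac L2|r|^2$. *)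

theory Defs
  imports "HOL-Analysis.Analysis" "HOL-Computational_Algebra.Polynomial"
begin

definition dir_deriv :: "('a::euclidean_space \<Rightarrow> real) \<Rightarrow> 'a \<Rightarrow> 'a \<Rightarrow> real"
  where "dir_deriv f v x = frechet_derivative f (at x) v"

text \<open>\<open>Ck k f\<close>: \<open>f\<close> is of class \<open>C\<^sup>k\<close> on the whole space. Continuity of the top-order derivatives
  is tested at level 0, after fixing \<open>k\<close> directions.\<close>

primrec Ck :: "nat \<Rightarrow> ('a::euclidean_space \<Rightarrow> real) \<Rightarrow> bool" where
  "Ck 0 f \<longleftrightarrow> continuous_on UNIV f"
| "Ck (Suc k) f \<longleftrightarrow> (\<forall>x. f differentiable (at x)) \<and> (\<forall>v. Ck k (dir_deriv f v))"

definition smooth :: "('a::euclidean_space \<Rightarrow> real) \<Rightarrow> bool"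
  where "smooth f \<longleftrightarrow> (\<forall>k. Ck k f)"

definition grad :: "('a::euclidean_space \<Rightarrow> real) \<Rightarrow> 'a \<Rightarrow> 'a"
  where "grad f x = (\<Sum>b\<in>Basis. dir_deriv f b x *\<^sub>R b)"

definition hessian :: "(real^'n \<Rightarrow> real) \<Rightarrow> real^'n \<Rightarrow> real^'n^'n"
  where "hessian f x = jacobian (grad f) (at x)"

definition taylor2 :: "('a::euclidean_space \<Rightarrow> real) \<Rightarrow> 'a \<Rightarrow> 'a \<Rightarrow> real"
  where "taylor2 f a x =
    f a + dir_deriv f (x - a) a + dir_deriv (dir_deriv f (x - a)) (x - a) a / 2"

definition eigval :: "'a::field^'n^'n \<Rightarrow> 'a \<Rightarrow> bool"
  where "eigval A x \<longleftrightarrow> (\<exists>v. v \<noteq> 0 \<and> A *v v = x *s v)"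

definition charpoly :: "'a::comm_ring_1^'n^'n \<Rightarrow> 'a poly"
  where "charpoly A = det (\<chi> i j. (if i = j then [:0, 1:] else 0) - [:A $ i $ j:])"

text \<open>The index \<open>s\<close> is the ``first'' one; \<open>lam s\<close> is never used.\<close>

definition eigenbasis :: "real^'n^'n \<Rightarrow> 'n \<Rightarrow> real \<Rightarrow> ('n \<Rightarrow> real) \<Rightarrow> real^'n^'n \<Rightarrow> bool"
  where "eigenbasis A s lams lam Q \<longleftrightarrow>
    orthogonal_matrix Q \<and>
    A *v column s Q = (- lams) *s column s Q \<and>
    (\<forall>i. i \<noteq> s \<longrightarrow> A *v column i Q = lam i *s column i Q)"

text \<open>Points are triples \<open>(\<theta>, p, r)\<close>. To speak of matrices, the phase space is identified with
  the coordinate space over \<open>'n \<times> 3\<close>, where \<open>(i, 1)\<close>, \<open>(i, 2)\<close>, \<open>(i, 3)\<close> index the \<open>i\<close>-th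
  coordinates of \<open>\<theta>\<close>, \<open>p\<close>, \<open>r\<close>.\<close>

type_synonym 'n phase = "(real^'n) \<times> (real^'n) \<times> (real^'n)"

fun flat :: "'n::finite phase \<Rightarrow> real^('n \<times> 3)"
  where "flat (\<theta>, p, r) = (\<chi> a. vector [\<theta> $ fst a, p $ fst a, r $ fst a] $ snd a)"

definition unflat :: "real^('n::finite \<times> 3) \<Rightarrow> 'n phase"
  where "unflat X = ((\<chi> i. X $ (i, 1)), (\<chi> i. X $ (i, 2)), (\<chi> i. X $ (i, 3)))"

fun drift :: "(real^'n \<Rightarrow> real) \<Rightarrow> real \<Rightarrow> real \<Rightarrow> 'n phase \<Rightarrow> 'n::finite phase"
  where "drift U L \<gamma> (\<theta>, p, r) =
    (p, - (1 / L) *\<^sub>R grad U \<theta> + \<gamma> *\<^sub>R r, - \<gamma> *\<^sub>R p - \<gamma> *\<^sub>R r)"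

definition drift_matrix ::
    "(real^'n \<Rightarrow> real) \<Rightarrow> real \<Rightarrow> real \<Rightarrow> real^'n \<Rightarrow> real^('n::finite \<times> 3)^('n \<times> 3)"
  where "drift_matrix U L \<gamma> \<sigma> =
    jacobian (\<lambda>X. flat (drift U L \<gamma> (unflat X))) (at (flat (\<sigma>, 0, 0)))"

fun drift_lin :: "(real^'n \<Rightarrow> real) \<Rightarrow> real \<Rightarrow> real \<Rightarrow> real^'n \<Rightarrow> 'n phase \<Rightarrow> 'n::finite phase"
  where "drift_lin U L \<gamma> \<sigma> (\<theta>, p, r) =
    (p, - (1 / L) *\<^sub>R (hessian U \<sigma> *v (\<theta> - \<sigma>)) + \<gamma> *\<^sub>R r, - \<gamma> *\<^sub>R p - \<gamma> *\<^sub>R r)"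

definition laplace_r :: "('n::finite phase \<Rightarrow> real) \<Rightarrow> 'n phase \<Rightarrow> real"
  where "laplace_r f x =
    (\<Sum>i\<in>UNIV. dir_deriv (dir_deriv f (0, 0, axis i 1)) (0, 0, axis i 1) x)"

definition generator_lin ::
    "(real^'n \<Rightarrow> real) \<Rightarrow> real \<Rightarrow> real \<Rightarrow> real \<Rightarrow> real^'n \<Rightarrow> ('n::finite phase \<Rightarrow> real) \<Rightarrow> 'n phase \<Rightarrow> real"
  where "generator_lin U L \<gamma> \<epsilon> \<sigma> f x =
    drift_lin U L \<gamma> \<sigma> x \<bullet> grad f x + (\<gamma> * \<epsilon> / L) * laplace_r f x"

fun hamiltonian :: "(real^'n \<Rightarrow> real) \<Rightarrow> real \<Rightarrow> 'n::finite phase \<Rightarrow> real"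
  where "hamiltonian U L (\<theta>, p, r) = U \<theta> + L / 2 * (norm p)\<^sup>2 + L / 2 * (norm r)\<^sup>2"

definition hamiltonian_quad :: "(real^'n \<Rightarrow> real) \<Rightarrow> real \<Rightarrow> real^'n \<Rightarrow> 'n::finite phase \<Rightarrow> real"
  where "hamiltonian_quad U L \<sigma> = taylor2 (hamiltonian U L) (\<sigma>, 0, 0)"

definition saddle_triple :: "real \<Rightarrow> real \<Rightarrow> real \<Rightarrow> real^3^3"
  where "saddle_triple L \<gamma> lams =
    vector [vector [0, 1, 0], vector [lams / L, 0, \<gamma>], vector [0, - \<gamma>, - \<gamma>]]"

definition normal_triple :: "real \<Rightarrow> real \<Rightarrow> real \<Rightarrow> real^3^3"
  where "normal_triple L \<gamma> h =
    vector [vector [0, 1, 0], vector [- h / L, 0, \<gamma>], vector [0, - \<gamma>, - \<gamma>]]"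

definition triple :: "real \<Rightarrow> real \<Rightarrow> 'n \<Rightarrow> real \<Rightarrow> ('n \<Rightarrow> real) \<Rightarrow> 'n \<Rightarrow> real^3^3"
  where "triple L \<gamma> s lams lam i =
    (if i = s then saddle_triple L \<gamma> lams else normal_triple L \<gamma> (lam i))"

definition block_diag :: "('n \<Rightarrow> real^3^3) \<Rightarrow> real^('n::finite \<times> 3)^('n \<times> 3)"
  where "block_diag B = (\<chi> a b. if fst a = fst b then B (fst a) $ snd a $ snd b else 0)"

definition saddle_cubic :: "real \<Rightarrow> real \<Rightarrow> real \<Rightarrow> real \<Rightarrow> real"
  where "saddle_cubic L \<gamma> lams \<mu> =
    \<mu>^3 + \<gamma> * \<mu>^2 + (\<gamma>^2 - lams / L) * \<mu> - \<gamma> * lams / L"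

definition mu_saddle :: "real \<Rightarrow> real \<Rightarrow> real \<Rightarrow> real"
  where "mu_saddle L \<gamma> lams = (THE \<mu>. \<mu> > 0 \<and> saddle_cubic L \<gamma> lams \<mu> = 0)"

definition lift_matrix :: "real^'n^'n \<Rightarrow> real^('n::finite \<times> 3)^('n \<times> 3)"
  where "lift_matrix Q = (\<chi> a b. if snd a = snd b then Q $ fst a $ fst b else 0)"

fun eigen_coords :: "real^'n^'n \<Rightarrow> real^'n \<Rightarrow> 'n phase \<Rightarrow> 'n::finite phase"
  where "eigen_coords Q \<sigma> (\<theta>, p, r) =
    (transpose Q *v (\<theta> - \<sigma>), transpose Q *v p, transpose Q *v r)"

text \<open>The part of a generator acting on the \<open>i\<close>-th triple: drift \<open>B (q\<^sub>i, v\<^sub>i, w\<^sub>i)\<close> in the three variables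
  \<open>q\<^sub>i, v\<^sub>i, w\<^sub>i\<close> and diffusion with coefficient \<open>\<kappa>\<close> in \<open>w\<^sub>i\<close>.\<close>

fun triple_generator :: "real^3^3 \<Rightarrow> real \<Rightarrow> 'n \<Rightarrow> ('n::finite phase \<Rightarrow> real) \<Rightarrow> 'n phase \<Rightarrow> real"
  where "triple_generator B \<kappa> i g (q, v, w) =
    (B *v vector [q $ i, v $ i, w $ i]) $ 1 * dir_deriv g (axis i 1, 0, 0) (q, v, w)
  + (B *v vector [q $ i, v $ i, w $ i]) $ 2 * dir_deriv g (0, axis i 1, 0) (q, v, w)
  + (B *v vector [q $ i, v $ i, w $ i]) $ 3 * dir_deriv g (0, 0, axis i 1) (q, v, w)
  + \<kappa> * dir_deriv (dir_deriv g (0, 0, axis i 1)) (0, 0, axis i 1) (q, v, w)"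

end

theory Submission
  imports Defs
begin

text \<open>The argument rests on the spectral theorem for the Hessian at the saddle. The Hessian is symmetric
because mixed second derivatives of a smooth function commute (\<open>second_dir_deriv_symmetric\<close>), a
symmetric matrix has an orthonormal basis of eigenvectors (\<open>symmetric_matrix_diagonalizable\<close>), and the
given characteristic polynomial fixes the eigenvalues with multiplicity, so that the basis can be
ordered as prescribed (\<open>ex_eigenbasis\<close>). The determinant of the Hessian is then the product of the
eigenvalues.

Let \<open>Q\<close> be an orthogonal matrix of eigenvectors. Applying \<open>transpose Q\<close> to each of \<open>\<theta> - \<sigma>\<close>, \<open>p\<close> and \<open>r\<close>
turns the linearized drift into independent drifts of the triples \<open>(q\<^sub>i, v\<^sub>i, w\<^sub>i)\<close>
(\<open>drift_lin_decouples\<close>). As the linearized drift is the derivative of the drift at the saddle, this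
gives the block-diagonal form of the drift matrix (\<open>drift_matrix_block_diag\<close>); and by the chain rule,
together with the invariance of the trace of a bilinear form under orthogonal maps, it gives the
decomposition of the generator (\<open>generator_lin_eigen_coords\<close>). The Hamiltonian is quadratic in \<open>p\<close> and
\<open>r\<close>, and the gradient vanishes at the saddle, so its second-order Taylor polynomial consists of
\<open>U \<sigma>\<close>, the Hessian form in \<open>\<theta> - \<sigma>\<close>, which becomes diagonal in \<open>q\<close>, and the kinetic terms, whose norms
\<open>Q\<close> preserves.

What remains concerns single triples. The cubic of the saddle triple has a unique positive root by
a monotonicity argument, and this root is simple because the derivative of the cubic is positive
there. A normal triple is stable because its energy is dissipated by the friction and no nonzero
eigenvector escapes the dissipation (\<open>normal_triple_stable\<close>).\<close>

section \<open>Directional derivatives and the Hessian\<close>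

lemma has_derivative_dir_deriv:
  assumes "f differentiable (at x)"
  shows "(f has_derivative (\<lambda>v. dir_deriv f v x)) (at x)"
  using assms unfolding dir_deriv_def by (simp add: frechet_derivative_works)

lemma linear_dir_deriv: "f differentiable (at x) \<Longrightarrow> linear (\<lambda>v. dir_deriv f v x)"
  using has_derivative_dir_deriv has_derivative_linear by blast

lemma dir_deriv_eq:
  assumes "(f has_derivative f') (at x)"
  shows "dir_deriv f v x = f' v"
  using frechet_derivative_at[OF assms] by (simp add: dir_deriv_def)

lemma grad_inner:
  assumes "f differentiable (at x)"
  shows "v \<bullet> grad f x = dir_deriv f v x"
proof -
  have "dir_deriv f v x = dir_deriv f (\<Sum>b\<in>Basis. (v \<bullet> b) *\<^sub>R b) x"
    by (simp add: euclidean_representation)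
  also have "\<dots> = (\<Sum>b\<in>Basis. (v \<bullet> b) * dir_deriv f b x)"
    by (simp add: linear_sum[OF linear_dir_deriv[OF assms]]
        linear_cmul[OF linear_dir_deriv[OF assms]])
  finally show ?thesis
    by (simp add: grad_def inner_sum_right mult.commute)
qed

lemma dir_deriv_compose:
  assumes "g differentiable (at (T x))" "(T has_derivative T') (at x)"
  shows "dir_deriv (g \<circ> T) v x = dir_deriv g (T' v) (T x)"
  using dir_deriv_eq[OF diff_chain_at[OF assms(2) has_derivative_dir_deriv[OF assms(1)]]]
  by simp

lemma Ck_2_iff:
  "Ck 2 f \<longleftrightarrow> (\<forall>x. f differentiable (at x)) \<and> (\<forall>v x. dir_deriv f v differentiable (at x))
     \<and> (\<forall>v w. continuous_on UNIV (dir_deriv (dir_deriv f v) w))"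
  by (auto simp: numeral_2_eq_2)

lemma DERIV_along_line:
  assumes "\<And>x. f differentiable (at x)"
  shows "DERIV (\<lambda>t. f (b + t *\<^sub>R u)) t :> dir_deriv f u (b + t *\<^sub>R u)"
proof -
  have 1: "((\<lambda>t. b + t *\<^sub>R u) has_derivative (\<lambda>t. t *\<^sub>R u)) (at t)"
    by (auto intro!: derivative_eq_intros)
  have "((\<lambda>t. f (b + t *\<^sub>R u)) has_derivative (\<lambda>s. dir_deriv f (s *\<^sub>R u) (b + t *\<^sub>R u))) (at t)"
    using diff_chain_at[OF 1 has_derivative_dir_deriv[OF assms]] by (simp add: o_def)
  then show ?thesis
    unfolding has_field_derivative_def
    by (simp add: linear_cmul[OF linear_dir_deriv[OF assms]] mult_commute_abs)
qed

text \<open>The mean value theorem, applied along \<open>u\<close> to the increment of \<open>f\<close> across \<open>h *\<^sub>R v\<close> and then along \<open>v\<close> to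
the derivative so obtained. The left-hand side is symmetric in \<open>u\<close> and \<open>v\<close>, and this is what
makes mixed derivatives commute.\<close>

lemma second_difference_mean_value:
  assumes "\<And>x. f differentiable (at x)" "\<And>x. dir_deriv f u differentiable (at x)" "h > 0"
  shows "\<exists>\<xi>\<in>{0<..<h}. \<exists>\<eta>\<in>{0<..<h}.
    f (a + h *\<^sub>R u + h *\<^sub>R v) - f (a + h *\<^sub>R u) - f (a + h *\<^sub>R v) + f a
      = h * h * dir_deriv (dir_deriv f u) v (a + \<xi> *\<^sub>R u + \<eta> *\<^sub>R v)"
proof -
  define g where "g = (\<lambda>t. f ((a + h *\<^sub>R v) + t *\<^sub>R u) - f (a + t *\<^sub>R u))"
  define g' where "g' t = dir_deriv f u ((a + h *\<^sub>R v) + t *\<^sub>R u) - dir_deriv f u (a + t *\<^sub>R u)" for t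
  have "DERIV g t :> g' t" for t
    unfolding g_def g'_def by (intro DERIV_diff DERIV_along_line assms)
  from MVT2[OF \<open>h > 0\<close> this] obtain \<xi> where \<xi>: "0 < \<xi>" "\<xi> < h" "g h - g 0 = h * g' \<xi>"
    by auto
  define k where "k = (\<lambda>t. dir_deriv f u ((a + \<xi> *\<^sub>R u) + t *\<^sub>R v))"
  have "DERIV k t :> dir_deriv (dir_deriv f u) v ((a + \<xi> *\<^sub>R u) + t *\<^sub>R v)" for t
    unfolding k_def by (intro DERIV_along_line assms)
  from MVT2[OF \<open>h > 0\<close> this] obtain \<eta> where
    \<eta>: "0 < \<eta>" "\<eta> < h" "k h - k 0 = h * dir_deriv (dir_deriv f u) v ((a + \<xi> *\<^sub>R u) + \<eta> *\<^sub>R v)"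
    by auto
  have "g' \<xi> = k h - k 0"
    by (simp add: g'_def k_def algebra_simps)
  with \<xi> \<eta> have "g h - g 0 = h * h * dir_deriv (dir_deriv f u) v (a + \<xi> *\<^sub>R u + \<eta> *\<^sub>R v)"
    by simp
  moreover have "g h - g 0
      = f (a + h *\<^sub>R u + h *\<^sub>R v) - f (a + h *\<^sub>R u) - f (a + h *\<^sub>R v) + f a"
    by (simp add: g_def algebra_simps)
  ultimately have "f (a + h *\<^sub>R u + h *\<^sub>R v) - f (a + h *\<^sub>R u) - f (a + h *\<^sub>R v) + f a
      = h * h * dir_deriv (dir_deriv f u) v (a + \<xi> *\<^sub>R u + \<eta> *\<^sub>R v)"
    by simp
  moreover have "\<xi> \<in> {0<..<h}" "\<eta> \<in> {0<..<h}" using \<xi> \<eta> by auto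
  ultimately show ?thesis by blast
qed

text \<open>Both mixed derivatives, evaluated at points of the parallelogram spanned by \<open>h *\<^sub>R u\<close> and \<open>h *\<^sub>R v\<close>,
are equal to the same second difference divided by \<open>h\<^sup>2\<close>. As \<open>h\<close> tends to 0 these points converge to \<open>a\<close>,
and continuity of the mixed derivatives identifies the limits.\<close>

lemma second_dir_deriv_symmetric:
  assumes "Ck 2 f"
  shows "dir_deriv (dir_deriv f u) v a = dir_deriv (dir_deriv f v) u a"
proof -
  have lim: "(\<lambda>n. dir_deriv (dir_deriv f u) v (a + \<xi> n *\<^sub>R u + \<eta> n *\<^sub>R v))
      \<longlonglongrightarrow> dir_deriv (dir_deriv f u) v a"
    if "\<And>n. \<xi> n \<in> {0<..<inverse (real (Suc n))}" "\<And>n. \<eta> n \<in> {0<..<inverse (real (Suc n))}"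
    for \<xi> \<eta> u v
  proof -
    have 0: "\<zeta> \<longlonglongrightarrow> 0" if "\<And>n. \<zeta> n \<in> {0<..<inverse (real (Suc n))}" for \<zeta> :: "nat \<Rightarrow> real"
      by (rule tendsto_sandwich[OF _ _ tendsto_const LIMSEQ_inverse_real_of_nat])
        (use that in \<open>auto intro!: always_eventually intro: less_imp_le\<close>)
    have "(\<lambda>n. a + \<xi> n *\<^sub>R u + \<eta> n *\<^sub>R v) \<longlonglongrightarrow> a + 0 *\<^sub>R u + 0 *\<^sub>R v"
      by (intro tendsto_intros 0 that)
    moreover have "isCont (dir_deriv (dir_deriv f u) v) a"
      using assms by (auto simp: Ck_2_iff continuous_on_eq_continuous_at)
    ultimately show ?thesis
      by (auto intro: isCont_tendsto_compose)
  qed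
  define \<Delta> where "\<Delta> h = f (a + h *\<^sub>R u + h *\<^sub>R v) - f (a + h *\<^sub>R u) - f (a + h *\<^sub>R v) + f a"
    for h :: real
  have d: "f differentiable (at x)" "dir_deriv f w differentiable (at x)" for x w
    using assms by (auto simp: Ck_2_iff)
  let ?h = "\<lambda>n. inverse (real (Suc n))"
  have pos: "?h n > 0" for n by simp
  have "\<exists>\<xi>\<in>{0<..<?h n}. \<exists>\<eta>\<in>{0<..<?h n}.
      \<Delta> (?h n) = ?h n * ?h n * dir_deriv (dir_deriv f u) v (a + \<xi> *\<^sub>R u + \<eta> *\<^sub>R v)" for n
    unfolding \<Delta>_def by (rule second_difference_mean_value[OF d pos])
  then obtain \<xi> \<eta> where 1: "\<xi> n \<in> {0<..<?h n}" "\<eta> n \<in> {0<..<?h n}"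
      "\<Delta> (?h n) = ?h n * ?h n * dir_deriv (dir_deriv f u) v (a + \<xi> n *\<^sub>R u + \<eta> n *\<^sub>R v)" for n
    by metis
  have sym: "\<Delta> h = f (a + h *\<^sub>R v + h *\<^sub>R u) - f (a + h *\<^sub>R v) - f (a + h *\<^sub>R u) + f a" for h
    by (simp add: \<Delta>_def algebra_simps)
  have "\<exists>\<xi>\<in>{0<..<?h n}. \<exists>\<eta>\<in>{0<..<?h n}.
      \<Delta> (?h n) = ?h n * ?h n * dir_deriv (dir_deriv f v) u (a + \<xi> *\<^sub>R v + \<eta> *\<^sub>R u)" for n
    unfolding sym by (rule second_difference_mean_value[OF d pos])
  then obtain \<xi>' \<eta>' where 2: "\<xi>' n \<in> {0<..<?h n}" "\<eta>' n \<in> {0<..<?h n}"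
      "\<Delta> (?h n) = ?h n * ?h n * dir_deriv (dir_deriv f v) u (a + \<xi>' n *\<^sub>R v + \<eta>' n *\<^sub>R u)" for n
    by metis
  have "dir_deriv (dir_deriv f u) v (a + \<xi> n *\<^sub>R u + \<eta> n *\<^sub>R v)
      = dir_deriv (dir_deriv f v) u (a + \<xi>' n *\<^sub>R v + \<eta>' n *\<^sub>R u)" for n
    using 1(3)[of n] 2(3)[of n] pos[of n] by simp
  with lim[OF 1(1,2), of u v] lim[OF 2(1,2), of v u] show ?thesis
    using LIMSEQ_unique by auto
qed

lemma has_derivative_grad:
  fixes f :: "real^'n \<Rightarrow> real"
  assumes "Ck 2 f"
  shows "(grad f has_derivative (\<lambda>h. hessian f x *v h)) (at x)"
proof -
  have "grad f differentiable (at x)"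
    unfolding grad_def[abs_def] using assms
    by (intro differentiable_sum differentiable_scaleR differentiable_const)
      (auto simp: Ck_2_iff)
  then show ?thesis by (simp add: jacobian_works hessian_def)
qed

text \<open>The inner product of the gradient with a fixed \<open>v\<close> is a directional derivative, so that
differentiating it again expresses the matrix \<open>hessian f x\<close>, which is defined as a Jacobian, by
iterated directional derivatives.\<close>

lemma inner_hessian:
  assumes "Ck 2 f"
  shows "v \<bullet> (hessian f x *v h) = dir_deriv (dir_deriv f v) h x"
proof -
  have "((\<lambda>x. v \<bullet> grad f x) has_derivative (\<lambda>h. v \<bullet> (hessian f x *v h))) (at x)"
    by (intro derivative_intros has_derivative_grad assms)
  moreover have "(\<lambda>x. v \<bullet> grad f x) = dir_deriv f v"
    using assms by (auto simp: Ck_2_iff grad_inner)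
  ultimately show ?thesis by (simp add: dir_deriv_eq)
qed

lemma transpose_hessian:
  assumes "Ck 2 f"
  shows "transpose (hessian f x) = hessian f x"
proof -
  have "hessian f x $ i $ j = dir_deriv (dir_deriv f (axis i 1)) (axis j 1) x" for i j
    using inner_hessian[OF assms, of "axis i 1" x "axis j 1"]
    by (simp add: inner_axis' matrix_vector_mul_component inner_axis)
  then show ?thesis
    using second_dir_deriv_symmetric[OF assms] by (simp add: transpose_def vec_eq_iff)
qed

section \<open>The spectral theorem for symmetric matrices\<close>

text \<open>A maximizer \<open>v\<close> of \<open>f x \<bullet> x\<close> over the unit sphere of \<open>S\<close>, with maximum \<open>c\<close>, is an eigenvector. Indeed
\<open>c * (x \<bullet> x) - f x \<bullet> x\<close> is a nonnegative quadratic form on \<open>S\<close> that vanishes at \<open>v\<close>, and a step from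
\<open>v\<close> along the residual \<open>c *\<^sub>R v - f v\<close>, which lies in \<open>S\<close>, would make it negative to first order
unless the residual is zero.\<close>

lemma exists_eigenvector_in_invariant_subspace:
  fixes f :: "'a::euclidean_space \<Rightarrow> 'a"
  assumes lin: "linear f" and sym: "\<And>x y. f x \<bullet> y = x \<bullet> f y"
    and S: "subspace S" "f ` S \<subseteq> S" "S \<noteq> {0}"
  shows "\<exists>v\<in>S. norm v = 1 \<and> (\<exists>c. f v = c *\<^sub>R v)"
proof -
  let ?K = "S \<inter> sphere 0 1"
  from S(1,3) obtain w where w: "w \<in> S" "w \<noteq> 0" using subspace_0 by blast
  then have "w /\<^sub>R norm w \<in> ?K" using S(1) by (simp add: subspace_mul)
  then have "?K \<noteq> {}" by blast
  moreover have "compact ?K" using closed_subspace[OF S(1)] by (simp add: closed_Int_compact)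
  moreover have "continuous_on ?K (\<lambda>x. f x \<bullet> x)"
    using lin by (intro continuous_on_inner continuous_on_id linear_continuous_on)
      (simp add: linear_conv_bounded_linear)
  ultimately have "\<exists>v\<in>?K. \<forall>x\<in>?K. f x \<bullet> x \<le> f v \<bullet> v"
    by (intro continuous_attains_sup)
  then obtain v where v: "v \<in> ?K" "\<And>x. x \<in> ?K \<Longrightarrow> f x \<bullet> x \<le> f v \<bullet> v" by blast
  define c where "c = f v \<bullet> v"
  define g where "g x = c * (x \<bullet> x) - f x \<bullet> x" for x
  have g_nonneg: "g x \<ge> 0" if "x \<in> S" for x
  proof (cases "x = 0")
    case True then show ?thesis by (simp add: g_def)
  next
    case False
    then have "x /\<^sub>R norm x \<in> ?K" using S(1) that by (simp add: subspace_mul)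
    from v(2)[OF this] have "(f x \<bullet> x) / (norm x)\<^sup>2 \<le> c"
      by (simp add: c_def linear_cmul[OF lin] power2_eq_square divide_inverse mult_ac)
    then show ?thesis using False
      by (simp add: g_def divide_le_eq power2_norm_eq_inner)
  qed
  define u where "u = c *\<^sub>R v - f v"
  have "u \<in> S" using v S unfolding u_def by (auto intro: subspace_diff subspace_mul)
  have "v \<bullet> v = 1" using v by (simp add: dot_square_norm)
  have g_line: "g (v + t *\<^sub>R u) = 2 * t * (u \<bullet> u) + t\<^sup>2 * g u" for t
  proof -
    have a: "f u \<bullet> v = f v \<bullet> u" using sym[of u v] by (simp add: inner_commute)
    have "g (v + t *\<^sub>R u) = g v + 2 * t * (c * (v \<bullet> u) - f v \<bullet> u) + t\<^sup>2 * g u"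
      by (simp add: g_def linear_add[OF lin] linear_cmul[OF lin] inner_simps a
          inner_commute[of u v] power2_eq_square algebra_simps)
    moreover have "g v = 0" using \<open>v \<bullet> v = 1\<close> by (simp add: g_def c_def)
    moreover have "c * (v \<bullet> u) - f v \<bullet> u = u \<bullet> u" by (simp add: u_def inner_simps inner_commute[of v "f v"])
    ultimately show ?thesis by simp
  qed
  have "u \<bullet> u = 0"
  proof (rule ccontr)
    assume "u \<bullet> u \<noteq> 0"
    then have pos: "u \<bullet> u > 0" by simp
    have gu: "g u \<ge> 0" using g_nonneg \<open>u \<in> S\<close> .
    \<comment> \<open>This choice gives \<open>- t * g u \<le> u \<bullet> u\<close>, half of the first-order coefficient \<open>2 * (u \<bullet> u)\<close>.\<close>
    define t where "t = - (u \<bullet> u) / (1 + g u)"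
    have "t < 0" using pos gu by (simp add: t_def divide_neg_pos)
    have "v + t *\<^sub>R u \<in> S" using v \<open>u \<in> S\<close> S(1) by (simp add: subspace_add subspace_mul)
    from g_nonneg[OF this] have "0 \<le> t * (2 * (u \<bullet> u) + t * g u)"
      by (simp add: g_line power2_eq_square algebra_simps)
    then have "2 * (u \<bullet> u) + t * g u \<le> 0"
      using \<open>t < 0\<close> by (simp add: zero_le_mult_iff)
    moreover have "t * g u \<ge> - (u \<bullet> u)"
      using pos gu by (simp add: t_def field_simps)
    ultimately show False using pos by simp
  qed
  then have "f v = c *\<^sub>R v" by (simp add: u_def)
  then show ?thesis using v by auto
qed

text \<open>An orthonormal set of eigenvectors with the largest possible cardinality spans the space. Its
orthogonal complement is invariant because the matrix is symmetric, so a nonzero complement would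
contain a further unit eigenvector.\<close>

lemma symmetric_matrix_diagonalizable:
  fixes A :: "real^'n^'n"
  assumes "transpose A = A"
  shows "\<exists>Q d. orthogonal_matrix Q \<and> (\<forall>i. A *v column i Q = d i *s column i Q)"
proof -
  let ?f = "\<lambda>x. A *v x"
  have lin: "linear ?f" by simp
  have sym: "?f x \<bullet> y = x \<bullet> ?f y" for x y
    by (metis assms dot_lmul_matrix vector_transpose_matrix)
  define P where "P B \<longleftrightarrow> pairwise orthogonal B \<and> (\<forall>b\<in>B. norm b = 1 \<and> (\<exists>c. ?f b = c *\<^sub>R b))" for B
  have indep: "independent B" if "P B" for B
    using that by (intro pairwise_orthogonal_independent) (auto simp: P_def)
  have bound: "finite B \<and> card B \<le> CARD('n)" if "P B" for B
    using independent_bound[OF indep[OF that]] by simp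
  have "P {}" by (simp add: P_def)
  then obtain B where B: "P B" "\<And>C. P C \<Longrightarrow> card C \<le> card B"
  proof -
    have "\<forall>C. P C \<longrightarrow> card C < Suc CARD('n)" using bound by (simp add: less_Suc_eq_le)
    from ex_has_greatest_nat[OF \<open>P {}\<close> this] show ?thesis using that by blast
  qed
  let ?S = "{y. \<forall>x\<in>B. orthogonal x y}"
  have "?S = {0}"
  proof (rule ccontr)
    assume "?S \<noteq> {0}"
    moreover have "?f ` ?S \<subseteq> ?S"
    proof safe
      fix y x assume y: "\<forall>x\<in>B. orthogonal x y" and "x \<in> B"
      then obtain c where "?f x = c *\<^sub>R x" using B(1) unfolding P_def by blast
      then show "orthogonal x (?f y)"
        using y \<open>x \<in> B\<close> by (simp add: orthogonal_def flip: sym)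
    qed
    ultimately have "\<exists>v\<in>?S. norm v = 1 \<and> (\<exists>c. ?f v = c *\<^sub>R v)"
      by (intro exists_eigenvector_in_invariant_subspace lin sym subspace_orthogonal_to_vectors)
    then obtain v c where v: "v \<in> ?S" "norm v = 1" "?f v = c *\<^sub>R v" by blast
    have "pairwise orthogonal (insert v B)"
      using B(1) v(1) by (simp add: P_def pairwise_insert orthogonal_commute)
    then have "P (insert v B)"
      using B(1) v(2,3) unfolding P_def by blast
    moreover have "v \<notin> B" using v by (auto simp: orthogonal_def)
    ultimately show False using B(2)[of "insert v B"] bound[OF B(1)] by simp
  qed
  have "span B = UNIV"
  proof (rule ccontr)
    assume "span B \<noteq> UNIV"
    then obtain a where "a \<noteq> 0" "\<And>x. x \<in> span B \<Longrightarrow> a \<bullet> x = 0"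
      using span_not_UNIV_orthogonal by blast
    then have "a \<in> ?S" by (simp add: orthogonal_def inner_commute span_base)
    with \<open>?S = {0}\<close> \<open>a \<noteq> 0\<close> show False by blast
  qed
  then have "card B = CARD('n)"
    using dim_eq_card_independent[OF indep[OF B(1)]] dim_span[of B] by (simp add: dim_UNIV)
  then obtain b where b: "bij_betw b (UNIV :: 'n set) B"
    using bound[OF B(1)] finite_same_card_bij[of "UNIV :: 'n set" B] by auto
  define Q :: "real^'n^'n" where "Q = (\<chi> i j. b j $ i)"
  have col: "column i Q = b i" for i by (simp add: Q_def column_def vec_eq_iff)
  have bB: "b i \<in> B" for i using b by (auto simp: bij_betw_def)
  have "orthogonal_matrix Q"
    unfolding orthogonal_matrix_orthonormal_columns col
  proof safe
    show "norm (b i) = 1" for i using B(1) bB by (auto simp: P_def)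
    show "orthogonal (b i) (b j)" if "i \<noteq> j" for i j
    proof -
      have "b i \<noteq> b j" using b that by (simp add: bij_betw_def inj_eq)
      moreover have "pairwise orthogonal B" using B(1) by (simp add: P_def)
      ultimately show ?thesis using bB by (auto dest: pairwiseD)
    qed
  qed
  moreover obtain d where d: "\<And>i. ?f (b i) = d i *\<^sub>R b i"
  proof -
    have "\<forall>i. \<exists>c. ?f (b i) = c *\<^sub>R b i" using B(1) bB unfolding P_def by blast
    then show ?thesis using that by (metis choice)
  qed
  moreover have "\<forall>i. A *v column i Q = d i *s column i Q"
    by (simp add: col d scalar_mult_eq_scaleR)
  ultimately show ?thesis by blast
qed

section \<open>Characteristic polynomials and eigenbases\<close>

lemma poly_det:
  fixes M :: "'a::comm_ring_1 poly^'n^'n"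
  shows "poly (det M) x = det (\<chi> i j. poly (M $ i $ j) x)"
  by (simp add: det_def poly_sum poly_prod)

lemma mat_vector_mul:
  fixes x :: "'a::comm_semiring_1"
  shows "(mat x :: 'a^'n^'n) *v v = x *s v"
  by (simp add: matrix_vector_mult_def mat_def vec_eq_iff if_distrib[of "\<lambda>c. c * _"] cong: if_cong)

lemma poly_charpoly:
  fixes A :: "'a::comm_ring_1^'n^'n"
  shows "poly (charpoly A) x = det (mat x - A)"
  unfolding charpoly_def poly_det
  by (intro arg_cong[where f = det]) (simp add: vec_eq_iff mat_def)

lemma eigval_iff_charpoly_root:
  fixes A :: "'a::field^'n^'n"
  shows "eigval A x \<longleftrightarrow> poly (charpoly A) x = 0"
proof -
  have "(mat x - A) *v v = 0 \<longleftrightarrow> A *v v = x *s v" for v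
    by (auto simp: matrix_vector_mult_diff_rdistrib mat_vector_mul)
  moreover have "det (mat x - A) \<noteq> 0 \<longleftrightarrow> (\<forall>v. (mat x - A) *v v = 0 \<longrightarrow> v = 0)"
    unfolding matrix_left_invertible_ker[symmetric] invertible_left_inverse[symmetric]
    by (rule invertible_det_nz[symmetric])
  ultimately show ?thesis unfolding eigval_def poly_charpoly by blast
qed

text \<open>A single family containing the negative eigenvalue at \<open>s\<close>, which turns products and sums over all
indices into uniform expressions.\<close>

definition eigenvalue :: "'n \<Rightarrow> real \<Rightarrow> ('n \<Rightarrow> real) \<Rightarrow> 'n \<Rightarrow> real" where
  "eigenvalue s lams lam i = (if i = s then - lams else lam i)"

lemma eigenbasis_iff:
  "eigenbasis A s lams lam Q \<longleftrightarrow> orthogonal_matrix Q \<and>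
    (\<forall>i. A *v column i Q = eigenvalue s lams lam i *s column i Q)"
  by (auto simp: eigenbasis_def eigenvalue_def)

definition diagonal :: "('n \<Rightarrow> 'a::zero) \<Rightarrow> 'a^'n^'n" where
  "diagonal d = (\<chi> i j. if i = j then d i else 0)"

lemma det_diagonal_matrix: "det (diagonal d :: 'a::comm_ring_1^'n^'n) = (\<Prod>i\<in>UNIV. d i)"
  by (subst det_diagonal) (auto simp: diagonal_def)

lemma diagonalized:
  fixes A Q :: "real^'n^'n"
  assumes "orthogonal_matrix Q" "\<And>i. A *v column i Q = d i *s column i Q"
  shows "transpose Q ** A ** Q = diagonal d"
proof -
  have "A ** Q = Q ** diagonal d"
    using assms(2)
    by (simp add: vec_eq_iff matrix_matrix_mult_def matrix_vector_mult_def column_def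
        diagonal_def if_distrib[of "\<lambda>c. _ * c"] cong: if_cong)
  then show ?thesis
    using assms(1) by (simp add: matrix_mul_assoc[symmetric] orthogonal_matrix)
      (simp add: matrix_mul_assoc)
qed

text \<open>Polynomials over the reals are determined by their values, which reduces the claim to
multiplicativity of real determinants.\<close>

lemma charpoly_orthogonal_conj:
  fixes A Q :: "real^'n^'n"
  assumes "orthogonal_matrix Q"
  shows "charpoly (transpose Q ** A ** Q) = charpoly A"
proof (intro poly_eq_poly_eq_iff[THEN iffD1] ext)
  fix x
  have QQ: "transpose Q ** Q = mat 1" using assms by (simp add: orthogonal_matrix)
  have "mat x - transpose Q ** A ** Q = transpose Q ** (mat x - A) ** Q"
  proof (subst matrix_eq, rule allI)
    fix v
    have "transpose Q *v (Q *v v) = v" using QQ by (simp add: matrix_vector_mul_assoc)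
    then show "(mat x - transpose Q ** A ** Q) *v v = (transpose Q ** (mat x - A) ** Q) *v v"
      by (simp add: matrix_vector_mult_diff_rdistrib matrix_vector_mult_diff_distrib mat_vector_mul
          scalar_mult_eq_scaleR matrix_vector_mult_scaleR flip: matrix_vector_mul_assoc)
  qed
  moreover have "det (transpose Q) * det Q = 1" using QQ by (metis det_I det_mul)
  ultimately show "poly (charpoly (transpose Q ** A ** Q)) x = poly (charpoly A) x"
    by (simp add: poly_charpoly det_mul mult.left_commute mult.commute)
qed

lemma charpoly_diagonal: "charpoly (diagonal d) = (\<Prod>i\<in>UNIV. [:- d i, 1:])"
proof -
  have "charpoly (diagonal d) = det (diagonal (\<lambda>i. [:- d i, 1:]))"
    unfolding charpoly_def by (intro arg_cong[where f = det]) (simp add: vec_eq_iff diagonal_def)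
  then show ?thesis by (simp add: det_diagonal_matrix)
qed

lemma order_prod_linear:
  assumes "finite I"
  shows "order x (\<Prod>i\<in>I. [:- d i, 1::'a::idom:]) = card {i\<in>I. d i = x}"
  using assms
proof (induction rule: finite_induct)
  case (insert i I)
  have nz: "[:- d i, 1:] * (\<Prod>i\<in>I. [:- d i, 1:]) \<noteq> 0"
    unfolding mult_eq_0_iff using insert.hyps by (simp add: prod_zero_iff)
  have "order x [:- d i, 1:] = (if d i = x then 1 else 0)"
    using order_power_n_n[of x 1] by (auto simp: order_0I)
  moreover have "{j \<in> insert i I. d j = x} = (if d i = x then insert i {j\<in>I. d j = x} else {j\<in>I. d j = x})"
    by auto
  ultimately show ?case
    using insert.hyps insert.IH order_mult[OF nz, of x] by simp
qed simp

text \<open>The order of the product at \<open>x\<close> counts the indices with root \<open>x\<close>, so the two families have the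
same multiset of values.\<close>

lemma exists_permutation_of_roots:
  fixes d e :: "'n::finite \<Rightarrow> 'a::idom"
  assumes "(\<Prod>i\<in>UNIV. [:- d i, 1:]) = (\<Prod>i\<in>UNIV. [:- e i, 1:])"
  shows "\<exists>p. p permutes UNIV \<and> (\<forall>i. e i = d (p i))"
proof -
  have "image_mset d (mset_set UNIV) = image_mset e (mset_set UNIV)"
  proof (rule multiset_eqI)
    fix x
    show "count (image_mset d (mset_set UNIV)) x = count (image_mset e (mset_set UNIV)) x"
      using assms order_prod_linear[of UNIV x d] order_prod_linear[of UNIV x e]
      by (simp add: count_image_mset vimage_def Int_def)
  qed
  from image_mset_eq_implies_permutes[OF _ this[symmetric]] show ?thesis by auto
qed

text \<open>Diagonalization yields the eigenvalues in some order. Comparing the two factorizations of the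
characteristic polynomial shows that this order differs from the prescribed one by a permutation,
with which the columns are rearranged.\<close>

lemma ex_eigenbasis:
  fixes A :: "real^'n^'n"
  assumes "transpose A = A"
    and "charpoly A = [:lams, 1:] * (\<Prod>i\<in>UNIV - {s}. [:- lam i, 1:])"
  shows "\<exists>Q. eigenbasis A s lams lam Q"
proof -
  let ?e = "eigenvalue s lams lam"
  obtain Q d where Q: "orthogonal_matrix Q" "\<And>i. A *v column i Q = d i *s column i Q"
    using symmetric_matrix_diagonalizable[OF assms(1)] by metis
  have "charpoly A = (\<Prod>i\<in>UNIV. [:- d i, 1:])"
    using charpoly_orthogonal_conj[OF Q(1), of A] by (simp add: diagonalized[OF Q] charpoly_diagonal)
  moreover have "charpoly A = (\<Prod>i\<in>UNIV. [:- ?e i, 1:])"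
    unfolding assms(2) by (subst prod.remove[of UNIV s]) (auto simp: eigenvalue_def intro!: prod.cong)
  ultimately obtain p where p: "p permutes UNIV" "\<And>i. ?e i = d (p i)"
    using exists_permutation_of_roots[of d ?e] by auto
  define R :: "real^'n^'n" where "R = (\<chi> i j. Q $ i $ p j)"
  have col: "column i R = column (p i) Q" for i
    by (simp add: R_def column_def)
  have "orthogonal_matrix R"
    using Q(1) permutes_inj[OF p(1)]
    unfolding orthogonal_matrix_orthonormal_columns col by (auto simp: inj_eq)
  then show ?thesis
    unfolding eigenbasis_iff using Q(2) p(2) by (auto simp: col intro!: exI[of _ R])
qed

lemma det_eigenbasis:
  assumes "eigenbasis A s lams lam Q"
  shows "- det A = lams * (\<Prod>i\<in>UNIV - {s}. lam i)"
proof -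
  have Q: "orthogonal_matrix Q" "\<And>i. A *v column i Q = eigenvalue s lams lam i *s column i Q"
    using assms by (auto simp: eigenbasis_iff)
  have "det (transpose Q ** A ** Q) = det A"
    using det_orthogonal_matrix[OF Q(1)] by (auto simp: det_mul)
  then have "det A = (\<Prod>i\<in>UNIV. eigenvalue s lams lam i)"
    by (simp add: diagonalized[OF Q] det_diagonal_matrix)
  also have "\<dots> = - lams * (\<Prod>i\<in>UNIV - {s}. lam i)"
    by (subst prod.remove[of UNIV s]) (auto simp: eigenvalue_def intro!: prod.cong)
  finally show ?thesis by simp
qed

section \<open>Spectra of the saddle and normal triples\<close>

lemma charpoly_saddle_triple:
  "charpoly (saddle_triple L \<gamma> lams) = [:- \<gamma> * lams / L, \<gamma>\<^sup>2 - lams / L, \<gamma>, 1:]"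
  by (simp add: charpoly_def saddle_triple_def det_3 power2_eq_square algebra_simps)

lemma poly_charpoly_saddle_triple:
  "poly (charpoly (saddle_triple L \<gamma> lams)) \<mu> = saddle_cubic L \<gamma> lams \<mu>"
  by (simp add: charpoly_saddle_triple saddle_cubic_def power2_eq_square power3_eq_cube algebra_simps)

text \<open>With \<open>a = lams / L\<close> the equation reads \<open>a = \<mu>\<^sup>2 + \<gamma>\<^sup>2 * \<mu> / (\<mu> + \<gamma>)\<close>, whose right-hand side
increases strictly from 0 to infinity on the positive half-line. The factorization in the
uniqueness step is this monotonicity after clearing denominators.\<close>

lemma ex1_saddle_cubic_root:
  assumes "lams > 0" "L > 0" "\<gamma> > 0"
  shows "\<exists>!\<mu>. \<mu> > 0 \<and> saddle_cubic L \<gamma> lams \<mu> = 0"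
proof -
  let ?f = "saddle_cubic L \<gamma> lams"
  define a where "a = lams / L"
  have a: "a > 0" using assms by (simp add: a_def)
  have f: "?f x = x^3 + \<gamma> * x\<^sup>2 + \<gamma>\<^sup>2 * x - a * (x + \<gamma>)" for x
    by (simp add: saddle_cubic_def a_def algebra_simps add_divide_distrib)
  have "?f 0 < 0" using a assms by (simp add: f)
  \<comment> \<open>Both \<open>b\<^sup>2 \<ge> a\<close> and \<open>\<gamma> * b \<ge> a\<close> hold, so that \<open>b\<close> lies beyond the root.\<close>
  define b where "b = 1 + a + a / \<gamma>"
  have b: "b > 0" using a assms by (simp add: b_def add_pos_pos)
  have "b\<^sup>2 \<ge> a"
  proof -
    have "a \<le> b * 1" using a assms by (simp add: b_def)
    also have "\<dots> \<le> b * b" using a assms b by (intro mult_left_mono) (auto simp: b_def)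
    finally show ?thesis by (simp add: power2_eq_square)
  qed
  moreover have "\<gamma> * b \<ge> a" using a assms by (simp add: b_def field_simps)
  ultimately have "0 \<le> b * (b\<^sup>2 - a) + \<gamma> * (\<gamma> * b - a)"
    using b assms by simp
  moreover have "?f b = b * (b\<^sup>2 - a) + \<gamma> * (\<gamma> * b - a) + \<gamma> * b\<^sup>2"
    by (simp add: f power2_eq_square power3_eq_cube algebra_simps)
  ultimately have "?f b > 0" using b assms by (simp add: add_nonneg_pos)
  have "continuous_on {0..b} ?f"
    unfolding saddle_cubic_def by (intro continuous_intros)
  then obtain \<mu> where \<mu>: "0 \<le> \<mu>" "?f \<mu> = 0"
    using IVT'[of ?f 0 0 b] \<open>?f 0 < 0\<close> \<open>?f b > 0\<close> b by auto
  then have "\<mu> > 0" using \<open>?f 0 < 0\<close> by (cases "\<mu> = 0") auto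
  have uniq: "\<not> x < y" if "x > 0" "y > 0" "?f x = 0" "?f y = 0" for x y
  proof
    assume "x < y"
    have "(x + \<gamma>) * ?f y - (y + \<gamma>) * ?f x
        = (y - x) * ((x + \<gamma>) * (y + \<gamma>) * (x + y) + \<gamma>^3)"
      by (simp add: f power2_eq_square power3_eq_cube algebra_simps)
    also have "\<dots> > 0" using that assms \<open>x < y\<close> by (simp add: add_pos_pos)
    finally show False using that by simp
  qed
  show ?thesis
    using \<mu> \<open>\<mu> > 0\<close> uniq by (intro ex1I[of _ \<mu>]) (auto simp: not_less intro: antisym)
qed

text \<open>Subtracting the equation for \<open>\<mu>\<close> from \<open>\<mu>\<close> times the derivative of the cubic leaves positive terms
only, so that the derivative does not vanish at the root.\<close>

lemma order_saddle_root:
  assumes "lams > 0" "L > 0" "\<gamma> > 0" "\<mu> > 0" "saddle_cubic L \<gamma> lams \<mu> = 0"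
  shows "order \<mu> (charpoly (saddle_triple L \<gamma> lams)) = 1"
proof -
  have nz: "charpoly (saddle_triple L \<gamma> lams) \<noteq> 0" by (simp add: charpoly_saddle_triple)
  let ?p = "charpoly (saddle_triple L \<gamma> lams)"
  have "\<mu> * poly (pderiv ?p) \<mu> = 2 * \<mu>^3 + \<gamma> * \<mu>\<^sup>2 + \<gamma> * lams / L"
    using assms(5) by (simp add: charpoly_saddle_triple saddle_cubic_def pderiv_pCons
        power2_eq_square power3_eq_cube algebra_simps)
  also have "\<dots> > 0" using assms by (simp add: add_pos_pos)
  finally have "poly (pderiv ?p) \<mu> \<noteq> 0" by auto
  moreover have "poly ?p \<mu> = 0" using assms(5) by (simp add: poly_charpoly_saddle_triple)
  ultimately show ?thesis
    using order_pderiv[of ?p \<mu>] order_root[of ?p \<mu>] order_root[of "pderiv ?p" \<mu>]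
      nz by (auto simp: pderiv_0)
qed

text \<open>The energy \<open>E = (h / L) * |q|\<^sup>2 + |v|\<^sup>2 + |w|\<^sup>2\<close> is dissipated only through the friction on \<open>w\<close>: the
couplings of \<open>q\<close> with \<open>v\<close> and of \<open>v\<close> with \<open>w\<close> are skew and contribute nothing to the real part.
An eigenvector \<open>(q, v, w)\<close> for \<open>z\<close> therefore satisfies \<open>Re z * E = - \<gamma> * |w|\<^sup>2\<close>. If \<open>Re z\<close> were
nonnegative, \<open>w\<close> would vanish, and the eigenvalue equations then force \<open>v\<close> and \<open>q\<close> to vanish too.\<close>

lemma normal_triple_stable:
  assumes "h > 0" "L > 0" "\<gamma> > 0"
    and "eigval (map_matrix complex_of_real (normal_triple L \<gamma> h)) z"
  shows "Re z < 0"
proof -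
  define k where "k = h / L"
  have k: "k > 0" using assms by (simp add: k_def)
  obtain x where x: "x \<noteq> 0"
      "map_matrix complex_of_real (normal_triple L \<gamma> h) *v x = z *s x"
    using assms(4) by (auto simp: eigval_def)
  define q v w where "q = x $ 1" and "v = x $ 2" and "w = x $ 3"
  have nz: "q \<noteq> 0 \<or> v \<noteq> 0 \<or> w \<noteq> 0"
    using x(1) by (auto simp: vec_eq_iff forall_3 q_def v_def w_def)
  have e: "v = z * q" "- complex_of_real k * q + complex_of_real \<gamma> * w = z * v"
      "- complex_of_real \<gamma> * v - complex_of_real \<gamma> * w = z * w"
    using x(2)[THEN arg_cong, of "\<lambda>y. y $ 1"] x(2)[THEN arg_cong, of "\<lambda>y. y $ 2"]
      x(2)[THEN arg_cong, of "\<lambda>y. y $ 3"]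
    by (simp_all add: matrix_vector_mult_def sum_3 map_matrix_def
        normal_triple_def q_def v_def w_def k_def mult.commute)
  define E where "E = k * (cmod q)\<^sup>2 + (cmod v)\<^sup>2 + (cmod w)\<^sup>2"
  have "z * complex_of_real E = complex_of_real k * (z * q) * cnj q + (z * v) * cnj v + (z * w) * cnj w"
    by (simp add: E_def complex_norm_square algebra_simps flip: of_real_power)
  also have "\<dots> = complex_of_real k * (v * cnj q - q * cnj v)
      + complex_of_real \<gamma> * (w * cnj v - v * cnj w) - complex_of_real (\<gamma> * (cmod w)\<^sup>2)"
    unfolding e(1)[symmetric] e(2)[symmetric] e(3)[symmetric]
    by (simp add: complex_norm_square algebra_simps flip: of_real_power)
  finally have zE: "Re z * E = - \<gamma> * (cmod w)\<^sup>2"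
    by (auto dest!: arg_cong[where f = Re] simp: algebra_simps)
  have E: "E > 0"
    using nz k by (auto simp: E_def add_pos_nonneg add_nonneg_pos)
  show ?thesis
  proof (rule ccontr)
    assume "\<not> Re z < 0"
    then have "0 \<le> Re z * E" using E by simp
    then have "\<gamma> * (cmod w)\<^sup>2 \<le> 0" by (simp add: zE)
    then have "w = 0" using assms by (simp add: mult_le_0_iff)
    then have "v = 0" using e(3) assms by simp
    then have "q = 0" using e(2) \<open>w = 0\<close> k by simp
    with \<open>v = 0\<close> \<open>w = 0\<close> nz show False by simp
  qed
qed

lemma saddle_positive_eigenvalue:
  assumes "lams > 0" "L > 0" "\<gamma> > 0"
  shows "{x. x > 0 \<and> eigval (saddle_triple L \<gamma> lams) x} = {mu_saddle L \<gamma> lams}"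
    and "order (mu_saddle L \<gamma> lams) (charpoly (saddle_triple L \<gamma> lams)) = 1"
proof -
  let ?P = "\<lambda>\<mu>. \<mu> > 0 \<and> saddle_cubic L \<gamma> lams \<mu> = 0"
  note ex1 = ex1_saddle_cubic_root[OF assms]
  have mu: "?P (mu_saddle L \<gamma> lams)"
    unfolding mu_saddle_def by (rule theI'[OF ex1])
  have "?P x \<longleftrightarrow> x = mu_saddle L \<gamma> lams" for x
    using ex1 mu by blast
  then show "{x. x > 0 \<and> eigval (saddle_triple L \<gamma> lams) x} = {mu_saddle L \<gamma> lams}"
    by (auto simp: eigval_iff_charpoly_root poly_charpoly_saddle_triple)
  show "order (mu_saddle L \<gamma> lams) (charpoly (saddle_triple L \<gamma> lams)) = 1"
    using mu order_saddle_root[OF assms] by blast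
qed

section \<open>The linearized drift in eigencoordinates\<close>

text \<open>The generator is expressed on triples of vectors and the drift matrix on flattened points. Reading
\<open>block_diag B\<close> as a vector field on triples lets a single decoupling statement serve both.\<close>

definition diag_drift :: "('n \<Rightarrow> real^3^3) \<Rightarrow> 'n::finite phase \<Rightarrow> 'n phase" where
  "diag_drift B x = unflat (block_diag B *v flat x)"

(* Both rules would unfold the terms flat x and transpose Q *v x in which the lemmas below are stated. *)
declare flat.simps [simp del] transpose_matrix_vector [simp del]

lemma flat_nth [simp]:
  "flat x $ (i, 1) = fst x $ i" "flat x $ (i, 2) = fst (snd x) $ i" "flat x $ (i, 3) = snd (snd x) $ i"
  by (cases x; simp add: flat.simps)+

lemma unflat_flat [simp]: "unflat (flat x) = x"
  by (simp add: unflat_def prod_eq_iff vec_eq_iff)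

lemma flat_unflat [simp]: "flat (unflat X) = X"
proof -
  have "\<forall>k. flat (unflat X) $ (i, k) = X $ (i, k)" for i
    by (simp add: unflat_def forall_3)
  then show ?thesis by (simp add: vec_eq_iff)
qed

lemma linear_flat: "linear flat"
proof (rule linearI)
  show "flat (x + y) = flat x + flat y" for x y :: "'n::finite phase"
  proof -
    have "\<forall>k. flat (x + y) $ (i, k) = (flat x + flat y) $ (i, k)" for i
      by (simp add: forall_3)
    then show ?thesis by (simp add: vec_eq_iff)
  qed
  show "flat (c *\<^sub>R x) = c *\<^sub>R flat x" for c and x :: "'n::finite phase"
  proof -
    have "\<forall>k. flat (c *\<^sub>R x) $ (i, k) = (c *\<^sub>R flat x) $ (i, k)" for i
      by (simp add: forall_3)
    then show ?thesis by (simp add: vec_eq_iff)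
  qed
qed

lemma linear_unflat: "linear unflat"
  by (rule linearI) (simp_all add: unflat_def vec_eq_iff)

lemma sum_phase_index:
  "(\<Sum>a\<in>(UNIV :: ('n::finite \<times> 3) set). f a) = (\<Sum>i\<in>UNIV. f (i, 1) + f (i, 2) + f (i, 3))"
  by (simp add: sum_3 sum.cartesian_product' flip: UNIV_Times_UNIV)

lemma block_diag_flat_nth:
  "(block_diag B *v flat (q, v, w)) $ (i, k) = (B i *v vector [q $ i, v $ i, w $ i]) $ k"
  by (simp add: matrix_vector_mult_def sum_phase_index block_diag_def sum_3
      if_distrib[of "\<lambda>c. c * _"] sum.distrib cong: if_cong)

lemma diag_drift:
  "diag_drift B (q, v, w) =
    ((\<chi> i. (B i *v vector [q $ i, v $ i, w $ i]) $ 1),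
     (\<chi> i. (B i *v vector [q $ i, v $ i, w $ i]) $ 2),
     (\<chi> i. (B i *v vector [q $ i, v $ i, w $ i]) $ 3))"
  by (simp only: diag_drift_def unflat_def block_diag_flat_nth)

lemma lift_matrix_flat:
  "lift_matrix P *v flat (q, v, w) = flat (P *v q, P *v v, P *v w)"
proof -
  have "\<forall>k. (lift_matrix P *v flat (q, v, w)) $ (i, k) = flat (P *v q, P *v v, P *v w) $ (i, k)" for i
    by (simp add: forall_3 matrix_vector_mult_def sum_phase_index lift_matrix_def)
  then show ?thesis by (simp add: vec_eq_iff)
qed

lemma transpose_lift_matrix: "transpose (lift_matrix Q) = lift_matrix (transpose Q)"
  by (auto simp: vec_eq_iff transpose_def lift_matrix_def)

text \<open>Centred at 0, the change to eigencoordinates is linear and is the derivative of the affine map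
\<open>eigen_coords Q \<sigma>\<close>; hence the appearance of \<open>eigen_coords Q 0\<close> in the sequel.\<close>

lemma transpose_lift_matrix_flat:
  "transpose (lift_matrix Q) *v flat x = flat (eigen_coords Q 0 x)"
  by (cases x) (simp add: transpose_lift_matrix lift_matrix_flat)

lemma orthogonal_lift_matrix:
  assumes "orthogonal_matrix Q"
  shows "orthogonal_matrix (lift_matrix Q)"
proof -
  have QQ: "transpose Q *v (Q *v x) = x" for x
    using assms by (simp add: orthogonal_matrix matrix_vector_mul_assoc)
  have "(transpose (lift_matrix Q) ** lift_matrix Q) *v X = mat 1 *v X" for X
  proof -
    obtain q v w where "X = flat (q, v, w)" by (metis flat_unflat prod_cases3)
    then show ?thesis
      by (simp add: transpose_lift_matrix lift_matrix_flat QQ flip: matrix_vector_mul_assoc)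
  qed
  then show ?thesis by (simp add: orthogonal_matrix matrix_eq)
qed

lemma flat_eigen_coords:
  "flat (eigen_coords Q \<sigma> (\<theta>, p, r)) = transpose (lift_matrix Q) *v (flat (\<theta>, p, r) - flat (\<sigma>, 0, 0))"
  by (simp add: transpose_lift_matrix_flat flip: linear_diff[OF linear_flat])

lemma transpose_eigenbasis_mult:
  assumes "eigenbasis A s lams lam Q"
  shows "transpose Q *v (A *v y) = (\<chi> i. eigenvalue s lams lam i * (transpose Q *v y) $ i)"
proof -
  have Q: "orthogonal_matrix Q" "\<And>i. A *v column i Q = eigenvalue s lams lam i *s column i Q"
    using assms by (auto simp: eigenbasis_iff)
  have "y = Q *v (transpose Q *v y)"
    using Q(1) by (simp add: orthogonal_matrix_def matrix_vector_mul_assoc)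
  then have "transpose Q *v (A *v y) = (transpose Q ** A ** Q) *v (transpose Q *v y)"
    by (simp flip: matrix_vector_mul_assoc)
  also have "\<dots> = (\<chi> i. eigenvalue s lams lam i * (transpose Q *v y) $ i)"
    unfolding diagonalized[OF Q]
    by (simp add: vec_eq_iff diagonal_def matrix_vector_mult_def[of "\<chi> i j. _ i j"]
        if_distrib[of "\<lambda>c. c * _"] cong: if_cong)
  finally show ?thesis .
qed

text \<open>The one computation behind both block-diagonal forms. The drift couples \<open>\<theta>\<close>, \<open>p\<close> and \<open>r\<close> through
scalars, which commute with \<open>transpose Q\<close>, and through the Hessian, which \<open>Q\<close> diagonalizes; so in
eigencoordinates it couples only components with the same index.\<close>

lemma drift_lin_decouples:
  assumes "eigenbasis (hessian U \<sigma>) s lams lam Q"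
  shows "eigen_coords Q 0 (drift_lin U L \<gamma> \<sigma> x)
    = diag_drift (triple L \<gamma> s lams lam) (eigen_coords Q \<sigma> x)"
proof -
  obtain \<theta> p r where x: "x = (\<theta>, p, r)" by (metis prod_cases3)
  show ?thesis
    unfolding x
    by (simp add: diag_drift matrix_vector_right_distrib matrix_vector_mult_diff_distrib
        matrix_vector_mult_scaleR transpose_eigenbasis_mult[OF assms] vec_eq_iff triple_def eigenvalue_def
        saddle_triple_def normal_triple_def matrix_vector_mult_def[of "vector _"] sum_3
        linear_neg[OF matrix_vector_mul_linear] right_diff_distrib diff_divide_distrib)
qed

text \<open>The field \<open>drift_lin\<close> is affine and vanishes at \<open>(\<sigma>, 0, 0)\<close>; shifting its argument by that point
gives its linear part.\<close>

lemma has_derivative_drift: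
  assumes "Ck 2 U"
  shows "(drift U L \<gamma> has_derivative (\<lambda>h. drift_lin U L \<gamma> \<sigma> (h + (\<sigma>, 0, 0)))) (at (\<sigma>, p, r))"
proof -
  have 1: "((\<lambda>x. grad U (fst x)) has_derivative (\<lambda>h. hessian U \<sigma> *v fst h)) (at (\<sigma>, p, r))"
    by (rule has_derivative_compose[OF bounded_linear_imp_has_derivative[OF bounded_linear_fst]])
      (simp add: has_derivative_grad[OF assms])
  have d: "drift U L \<gamma> = (\<lambda>x. (fst (snd x), - (1 / L) *\<^sub>R grad U (fst x) + \<gamma> *\<^sub>R snd (snd x),
      - \<gamma> *\<^sub>R fst (snd x) - \<gamma> *\<^sub>R snd (snd x)))"
    by auto
  have dl: "(\<lambda>h. drift_lin U L \<gamma> \<sigma> (h + (\<sigma>, 0, 0))) =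
     (\<lambda>h. (fst (snd h), - (1 / L) *\<^sub>R (hessian U \<sigma> *v fst h) + \<gamma> *\<^sub>R snd (snd h),
      - \<gamma> *\<^sub>R fst (snd h) - \<gamma> *\<^sub>R snd (snd h)))"
    by auto
  show ?thesis unfolding d dl
    by (intro derivative_intros 1)
qed

lemma drift_matrix_mult:
  assumes "Ck 2 U"
  shows "drift_matrix U L \<gamma> \<sigma> *v flat h = flat (drift_lin U L \<gamma> \<sigma> (h + (\<sigma>, 0, 0)))"
proof -
  let ?F = "\<lambda>X. flat (drift U L \<gamma> (unflat X))"
  let ?F' = "\<lambda>X. flat (drift_lin U L \<gamma> \<sigma> (unflat X + (\<sigma>, 0, 0)))"
  have u: "(unflat has_derivative unflat) (at (flat (\<sigma>, 0, 0)))"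
    by (intro linear_imp_has_derivative linear_unflat)
  have "(drift U L \<gamma> has_derivative (\<lambda>h. drift_lin U L \<gamma> \<sigma> (h + (\<sigma>, 0, 0)))) (at (unflat (flat (\<sigma>, 0, 0))))"
    using has_derivative_drift[OF assms] by simp
  from diff_chain_at[OF diff_chain_at[OF u this] linear_imp_has_derivative[OF linear_flat]]
  have F: "(?F has_derivative ?F') (at (flat (\<sigma>, 0, 0)))"
    by (simp add: o_def)
  then have "(?F has_derivative (\<lambda>X. drift_matrix U L \<gamma> \<sigma> *v X)) (at (flat (\<sigma>, 0, 0)))"
    unfolding drift_matrix_def using jacobian_works differentiableI by blast
  then have "(\<lambda>X. drift_matrix U L \<gamma> \<sigma> *v X) = ?F'"
    using F by (rule has_derivative_unique)
  from fun_cong[OF this, of "flat h"] show ?thesis by simp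
qed

lemma drift_matrix_block_diag:
  assumes "Ck 2 U" and E: "eigenbasis (hessian U \<sigma>) s lams lam Q"
  shows "transpose (lift_matrix Q) ** drift_matrix U L \<gamma> \<sigma> ** lift_matrix Q
    = block_diag (triple L \<gamma> s lams lam)"
proof -
  have QQ: "transpose Q *v (Q *v x) = x" for x
    using E by (simp add: eigenbasis_iff orthogonal_matrix matrix_vector_mul_assoc)
  have "(transpose (lift_matrix Q) ** drift_matrix U L \<gamma> \<sigma> ** lift_matrix Q) *v X
    = block_diag (triple L \<gamma> s lams lam) *v X" for X
  proof -
    obtain q v w where X: "X = flat (q, v, w)" by (metis flat_unflat prod_cases3)
    let ?x = "(Q *v q, Q *v v, Q *v w)"
    have "(transpose (lift_matrix Q) ** drift_matrix U L \<gamma> \<sigma> ** lift_matrix Q) *v X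
      = flat (eigen_coords Q 0 (drift_lin U L \<gamma> \<sigma> (?x + (\<sigma>, 0, 0))))"
      by (simp only: X lift_matrix_flat drift_matrix_mult[OF assms(1)] transpose_lift_matrix_flat
          flip: matrix_vector_mul_assoc)
    also have "\<dots> = flat (diag_drift (triple L \<gamma> s lams lam) (q, v, w))"
      by (simp only: drift_lin_decouples[OF E]) (simp add: QQ)
    finally show ?thesis by (simp add: X diag_drift_def)
  qed
  then show ?thesis by (simp add: matrix_eq)
qed

section \<open>The quadratic Hamiltonian\<close>

lemma norm_transpose_orthogonal:
  fixes Q :: "real^'n^'n"
  assumes "orthogonal_matrix Q"
  shows "norm (transpose Q *v x) = norm x"
  using assms orthogonal_transformation_matrix[of "\<lambda>x. transpose Q *v x"]
  by (intro orthogonal_transformation_norm) simp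

lemma dir_deriv_hamiltonian:
  assumes "\<And>x. U differentiable (at x)"
  shows "dir_deriv (hamiltonian U L) h = (\<lambda>x. dir_deriv U (fst h) (fst x)
    + L * (fst (snd x) \<bullet> fst (snd h)) + L * (snd (snd x) \<bullet> snd (snd h)))"
proof
  fix x :: "'a phase"
  have 1: "((\<lambda>x. U (fst x)) has_derivative (\<lambda>h. dir_deriv U (fst h) (fst x))) (at x)"
    using diff_chain_at[OF has_derivative_fst[OF has_derivative_ident] has_derivative_dir_deriv[OF assms]]
    by (simp add: o_def)
  have H: "hamiltonian U L = (\<lambda>x. U (fst x) + L / 2 * (fst (snd x) \<bullet> fst (snd x))
      + L / 2 * (snd (snd x) \<bullet> snd (snd x)))"
    by (auto simp: power2_norm_eq_inner)
  show "dir_deriv (hamiltonian U L) h x = dir_deriv U (fst h) (fst x)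
    + L * (fst (snd x) \<bullet> fst (snd h)) + L * (snd (snd x) \<bullet> snd (snd h))"
    unfolding H
    by (rule dir_deriv_eq[THEN trans], (rule derivative_intros 1)+)
      (simp add: inner_commute algebra_simps)
qed

lemma second_dir_deriv_hamiltonian:
  assumes "Ck 2 U"
  shows "dir_deriv (dir_deriv (hamiltonian U L) h) h x = dir_deriv (dir_deriv U (fst h)) (fst h) (fst x)
    + L * (fst (snd h) \<bullet> fst (snd h)) + L * (snd (snd h) \<bullet> snd (snd h))"
proof -
  have d: "U differentiable (at y)" "dir_deriv U (fst h) differentiable (at y)" for y
    using assms by (simp_all only: Ck_2_iff)
  have 1: "((\<lambda>x. dir_deriv U (fst h) (fst x)) has_derivative
      (\<lambda>k. dir_deriv (dir_deriv U (fst h)) (fst k) (fst x))) (at x)"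
    using diff_chain_at[OF has_derivative_fst[OF has_derivative_ident] has_derivative_dir_deriv[OF d(2)]]
    by (simp add: o_def)
  show ?thesis
    unfolding dir_deriv_hamiltonian[OF d(1)]
    by (rule dir_deriv_eq[THEN trans], (rule derivative_intros 1)+) simp
qed

lemma hamiltonian_quad_eq:
  assumes "Ck 2 U" "grad U \<sigma> = 0"
  shows "hamiltonian_quad U L \<sigma> (\<theta>, p, r) = U \<sigma>
    + (\<theta> - \<sigma>) \<bullet> (hessian U \<sigma> *v (\<theta> - \<sigma>)) / 2 + L / 2 * (norm p)\<^sup>2 + L / 2 * (norm r)\<^sup>2"
proof -
  have d: "U differentiable (at y)" for y using assms by (simp_all only: Ck_2_iff)
  have "dir_deriv U (\<theta> - \<sigma>) \<sigma> = 0"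
    using grad_inner[OF d, of "\<theta> - \<sigma>" \<sigma>] assms(2) by simp
  then show ?thesis
    unfolding hamiltonian_quad_def taylor2_def second_dir_deriv_hamiltonian[OF assms(1)]
    by (simp add: dir_deriv_hamiltonian[OF d] inner_hessian[OF assms(1)] power2_norm_eq_inner add_divide_distrib)
qed

lemma quadratic_form_eigenbasis:
  fixes y :: "real^'n"
  assumes "eigenbasis A s lams lam Q"
  defines "q \<equiv> transpose Q *v y"
  shows "y \<bullet> (A *v y) = - lams * (q $ s)\<^sup>2 + (\<Sum>i\<in>UNIV - {s}. lam i * (q $ i)\<^sup>2)"
proof -
  have "y = Q *v q"
    using assms by (simp add: q_def eigenbasis_iff orthogonal_matrix_def matrix_vector_mul_assoc)
  then have "y \<bullet> (A *v y) = q \<bullet> (transpose Q *v (A *v y))"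
    by (metis dot_lmul_matrix vector_transpose_matrix transpose_transpose)
  also have "\<dots> = (\<Sum>i\<in>UNIV. eigenvalue s lams lam i * (q $ i)\<^sup>2)"
    by (simp add: transpose_eigenbasis_mult[OF assms(1)] inner_vec_def q_def power2_eq_square mult_ac)
  also have "\<dots> = - lams * (q $ s)\<^sup>2 + (\<Sum>i\<in>UNIV - {s}. lam i * (q $ i)\<^sup>2)"
    by (subst sum.remove[of UNIV s]) (auto simp: eigenvalue_def intro!: sum.cong)
  finally show ?thesis .
qed

section \<open>The linearized generator\<close>

lemma linear_phase_expansion:
  fixes f :: "'n::finite phase \<Rightarrow> real"
  assumes "linear f"
  shows "f (a, b, c) = (\<Sum>i\<in>UNIV. a $ i * f (axis i 1, 0, 0) + b $ i * f (0, axis i 1, 0)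
    + c $ i * f (0, 0, axis i 1))"
proof -
  have e: "(\<Sum>i\<in>UNIV. x $ i *\<^sub>R axis i 1) = x" for x :: "real^'n"
    by (simp add: basis_expansion flip: scalar_mult_eq_scaleR)
  have "linear (\<lambda>x. (x, 0, 0) :: 'n phase)" "linear (\<lambda>x. (0, x, 0) :: 'n phase)"
     "linear (\<lambda>x. (0, 0, x) :: 'n phase)"
    by (auto intro!: linearI)
  note l = this[THEN linear_compose[OF _ assms], unfolded o_def]
  have "f (a, b, c) = f (a, 0, 0) + f (0, b, 0) + f (0, 0, c)"
    by (simp flip: linear_add[OF assms])
  also have "f (a, 0, 0) = (\<Sum>i\<in>UNIV. a $ i * f (axis i 1, 0, 0))"
    by (subst e[symmetric]) (simp only: linear_sum[OF l(1)] linear_cmul[OF l(1)] real_scaleR_def)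
  also have "f (0, b, 0) = (\<Sum>i\<in>UNIV. b $ i * f (0, axis i 1, 0))"
    by (subst e[symmetric]) (simp only: linear_sum[OF l(2)] linear_cmul[OF l(2)] real_scaleR_def)
  also have "f (0, 0, c) = (\<Sum>i\<in>UNIV. c $ i * f (0, 0, axis i 1))"
    by (subst e[symmetric]) (simp only: linear_sum[OF l(3)] linear_cmul[OF l(3)] real_scaleR_def)
  finally show ?thesis by (simp add: sum.distrib)
qed

text \<open>Linearity in \<open>v\<close> is differentiability of \<open>dir_deriv g u\<close>, and symmetry transfers it to \<open>u\<close>.\<close>

lemma bilinear_second_dir_deriv:
  assumes "Ck 2 g"
  shows "bilinear (\<lambda>u v. dir_deriv (dir_deriv g u) v x)"
proof -
  have d: "g differentiable (at y)" "dir_deriv g u differentiable (at y)" for y u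
    using assms by (simp_all only: Ck_2_iff)
  have "linear (\<lambda>u. dir_deriv (dir_deriv g u) v x)" for v
    unfolding second_dir_deriv_symmetric[OF assms, of _ v] by (rule linear_dir_deriv[OF d(2)])
  then show ?thesis
    unfolding bilinear_def using linear_dir_deriv[OF d(2)] by blast
qed

text \<open>The two sides are the trace of \<open>B\<close> computed in two orthonormal bases. Applied to second derivatives
it says that the Laplacian is invariant under orthogonal changes of variables.\<close>

lemma trace_orthogonal_invariant:
  fixes B :: "real^'n \<Rightarrow> real^'n \<Rightarrow> real"
  assumes B: "bilinear B" and P: "orthogonal_matrix P"
  shows "(\<Sum>i\<in>UNIV. B (P *v axis i 1) (P *v axis i 1)) = (\<Sum>i\<in>UNIV. B (axis i 1) (axis i 1))"
proof -
  have e: "P *v axis i 1 = (\<Sum>j\<in>UNIV. P $ j $ i *\<^sub>R axis j 1)" for i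
    by (simp add: matrix_vector_mult_basis column_def vec_eq_iff)
      (simp add: axis_def if_distrib[of "\<lambda>c. _ * c"] cong: if_cong)
  have "P ** transpose P = mat 1" using P by (simp add: orthogonal_matrix_def)
  then have o: "(\<Sum>i\<in>UNIV. P $ j $ i * P $ k $ i) = (if j = k then 1 else 0)" for j k
    by (simp add: vec_eq_iff matrix_matrix_mult_def transpose_def mat_def)
  have "(\<Sum>i\<in>UNIV. B (P *v axis i 1) (P *v axis i 1))
      = (\<Sum>i\<in>UNIV. \<Sum>j\<in>UNIV. \<Sum>k\<in>UNIV. P $ j $ i * P $ k $ i * B (axis j 1) (axis k 1))"
    by (simp only: e bilinear_sum[OF B] sum.cartesian_product[symmetric])
      (simp add: bilinear_lmul[OF B] bilinear_rmul[OF B] mult_ac)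
  also have "\<dots> = (\<Sum>j\<in>UNIV. \<Sum>k\<in>UNIV. \<Sum>i\<in>UNIV. P $ j $ i * P $ k $ i * B (axis j 1) (axis k 1))"
    by (subst sum.swap) (intro sum.cong refl sum.swap)
  also have "\<dots> = (\<Sum>j\<in>UNIV. \<Sum>k\<in>UNIV. if j = k then B (axis j 1) (axis k 1) else 0)"
    by (simp add: o flip: sum_distrib_right)
      (simp add: if_distrib[of "\<lambda>c. c * _"] cong: if_cong)
  also have "\<dots> = (\<Sum>i\<in>UNIV. B (axis i 1) (axis i 1))"
    by simp
  finally show ?thesis .
qed

lemma has_derivative_eigen_coords:
  "(eigen_coords Q \<sigma> has_derivative eigen_coords Q 0) (at x)"
proof -
  have e: "eigen_coords Q \<tau> =
      (\<lambda>x. (transpose Q *v (fst x - \<tau>), transpose Q *v fst (snd x), transpose Q *v snd (snd x)))" for \<tau>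
    by auto
  have m: "((\<lambda>x. transpose Q *v f x) has_derivative (\<lambda>h. transpose Q *v f' h)) (at x)"
    if "(f has_derivative f') (at x)" for f f'
    by (rule bounded_linear.has_derivative[OF matrix_vector_mul_bounded_linear that])
  have "((\<lambda>x. fst x - \<sigma>) has_derivative (\<lambda>h. fst h - 0)) (at x)"
    "((\<lambda>x. fst (snd x)) has_derivative (\<lambda>h. fst (snd h))) (at x)"
    "((\<lambda>x. snd (snd x)) has_derivative (\<lambda>h. snd (snd h))) (at x)"
    by (intro derivative_intros)+
  then show ?thesis unfolding e by (intro has_derivative_Pair m)
qed

lemma dir_deriv_eigen_coords:
  assumes "\<And>y. g differentiable (at y)"
  shows "dir_deriv (g \<circ> eigen_coords Q \<sigma>) v = dir_deriv g (eigen_coords Q 0 v) \<circ> eigen_coords Q \<sigma>"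
  by (rule ext) (simp only: o_apply dir_deriv_compose[OF assms has_derivative_eigen_coords])

lemma laplace_r_eigen_coords:
  assumes "Ck 2 g" "orthogonal_matrix Q"
  shows "laplace_r (g \<circ> eigen_coords Q \<sigma>) x = laplace_r g (eigen_coords Q \<sigma> x)"
proof -
  have d: "g differentiable (at y)" "dir_deriv g u differentiable (at y)" for y u
    using assms by (simp_all only: Ck_2_iff)
  let ?B = "\<lambda>u v. dir_deriv (dir_deriv g (0, 0, u)) (0, 0, v) (eigen_coords Q \<sigma> x)"
  have "linear (\<lambda>x. (0, 0, x) :: 'a phase)"
    by (auto intro!: linearI)
  then have "bilinear ?B"
    using bilinear_second_dir_deriv[OF assms(1), of "eigen_coords Q \<sigma> x"]
    unfolding bilinear_def by (auto intro: linear_compose[unfolded o_def])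
  then have "(\<Sum>i\<in>UNIV. ?B (transpose Q *v axis i 1) (transpose Q *v axis i 1))
      = (\<Sum>i\<in>UNIV. ?B (axis i 1) (axis i 1))"
    using assms(2) by (intro trace_orthogonal_invariant) simp_all
  then show ?thesis
    by (simp add: laplace_r_def dir_deriv_eigen_coords[OF d(1)] dir_deriv_eigen_coords[OF d(2)])
qed

text \<open>By the chain rule the first-order part differentiates \<open>g\<close> along the transformed drift, which
decouples; expanding the direction in coordinates gives one summand per triple, and the invariant
Laplacian distributes its second derivatives over the same indices.\<close>

lemma generator_lin_eigen_coords:
  assumes "Ck 2 g" and E: "eigenbasis (hessian U \<sigma>) s lams lam Q"
  shows "generator_lin U L \<gamma> \<epsilon> \<sigma> (g \<circ> eigen_coords Q \<sigma>) x
    = (\<Sum>i\<in>UNIV. triple_generator (triple L \<gamma> s lams lam i) (\<gamma> * \<epsilon> / L) i g (eigen_coords Q \<sigma> x))"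
proof -
  have d: "g differentiable (at y)" for y
    using assms by (simp_all only: Ck_2_iff)
  have d': "(g \<circ> eigen_coords Q \<sigma>) differentiable (at y)" for y
    using differentiable_chain_at[OF _ d] has_derivative_eigen_coords differentiableI by blast
  obtain q v w where y: "eigen_coords Q \<sigma> x = (q, v, w)" by (metis prod_cases3)
  have "orthogonal_matrix Q" using E by (simp add: eigenbasis_iff)
  note lap = laplace_r_eigen_coords[OF assms(1) this]
  have "drift_lin U L \<gamma> \<sigma> x \<bullet> grad (g \<circ> eigen_coords Q \<sigma>) x
    = dir_deriv g (diag_drift (triple L \<gamma> s lams lam) (q, v, w)) (q, v, w)"
    by (simp add: grad_inner[OF d'] dir_deriv_eigen_coords[OF d] drift_lin_decouples[OF E] y)
  also have "\<dots> = (\<Sum>i\<in>UNIV.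
     (triple L \<gamma> s lams lam i *v vector [q $ i, v $ i, w $ i]) $ 1 * dir_deriv g (axis i 1, 0, 0) (q, v, w)
   + (triple L \<gamma> s lams lam i *v vector [q $ i, v $ i, w $ i]) $ 2 * dir_deriv g (0, axis i 1, 0) (q, v, w)
   + (triple L \<gamma> s lams lam i *v vector [q $ i, v $ i, w $ i]) $ 3 * dir_deriv g (0, 0, axis i 1) (q, v, w))"
    unfolding diag_drift by (subst linear_phase_expansion[OF linear_dir_deriv[OF d]]) simp
  finally show ?thesis
    unfolding generator_lin_def lap y by (simp add: laplace_r_def sum.distrib sum_distrib_left)
qed

section \<open>Decomposition at an index-one saddle\<close>

theorem lemma3p2:
  fixes U :: "real^'n \<Rightarrow> real" and \<sigma> :: "real^'n"
    and s :: 'n and lams :: real and lam :: "'n \<Rightarrow> real" and L \<gamma> \<epsilon> :: real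
  assumes "smooth U"
    and "grad U \<sigma> = 0"
    and "charpoly (hessian U \<sigma>) = [:lams, 1:] * (\<Prod>i\<in>UNIV - {s}. [:- lam i, 1:])"
    and "lams > 0" and "\<And>i. i \<noteq> s \<Longrightarrow> lam i > 0"
    and "L > 0" and "\<gamma> > 0" and "\<epsilon> > 0"
  shows
    "(\<exists>Q. eigenbasis (hessian U \<sigma>) s lams lam Q) \<and>
     (\<forall>Q. eigenbasis (hessian U \<sigma>) s lams lam Q \<longrightarrow>
        orthogonal_matrix (lift_matrix Q) \<and>
        transpose (lift_matrix Q) ** drift_matrix U L \<gamma> \<sigma> ** lift_matrix Q
          = block_diag (triple L \<gamma> s lams lam) \<and>
        (\<forall>\<theta> p r. flat (eigen_coords Q \<sigma> (\<theta>, p, r))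
          = transpose (lift_matrix Q) *v (flat (\<theta>, p, r) - flat (\<sigma>, 0, 0))) \<and>
        (\<forall>\<theta> p r q v w. (q, v, w) = eigen_coords Q \<sigma> (\<theta>, p, r) \<longrightarrow>
          (norm v)\<^sup>2 + (norm w)\<^sup>2 = (norm p)\<^sup>2 + (norm r)\<^sup>2 \<and>
          hamiltonian_quad U L \<sigma> (\<theta>, p, r)
            = U \<sigma> - lams / 2 * (q $ s)\<^sup>2 + 1 / 2 * (\<Sum>i\<in>UNIV - {s}. lam i * (q $ i)\<^sup>2)
              + L / 2 * (norm v)\<^sup>2 + L / 2 * (norm w)\<^sup>2) \<and>
        (\<forall>g x. Ck 2 g \<longrightarrow>
          laplace_r (g \<circ> eigen_coords Q \<sigma>) x = laplace_r g (eigen_coords Q \<sigma> x) \<and>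
          generator_lin U L \<gamma> \<epsilon> \<sigma> (g \<circ> eigen_coords Q \<sigma>) x
            = (\<Sum>i\<in>UNIV. triple_generator (triple L \<gamma> s lams lam i) (\<gamma> * \<epsilon> / L) i g
                (eigen_coords Q \<sigma> x)))) \<and>
     charpoly (saddle_triple L \<gamma> lams) = [:- \<gamma> * lams / L, \<gamma>\<^sup>2 - lams / L, \<gamma>, 1:] \<and>
     (\<exists>!\<mu>. \<mu> > 0 \<and> saddle_cubic L \<gamma> lams \<mu> = 0) \<and>
     {x. x > 0 \<and> eigval (saddle_triple L \<gamma> lams) x} = {mu_saddle L \<gamma> lams} \<and>
     order (mu_saddle L \<gamma> lams) (charpoly (saddle_triple L \<gamma> lams)) = 1 \<and>
     (\<forall>i z. i \<noteq> s \<longrightarrow>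
        eigval (map_matrix complex_of_real (normal_triple L \<gamma> (lam i))) z \<longrightarrow> Re z < 0) \<and>
     - det (hessian U \<sigma>) = lams * (\<Prod>i\<in>UNIV - {s}. lam i)"
proof -
  have C: "Ck 2 U" using assms(1) by (simp add: smooth_def)
  have sym: "transpose (hessian U \<sigma>) = hessian U \<sigma>" by (rule transpose_hessian[OF C])
  have ex: "\<exists>Q. eigenbasis (hessian U \<sigma>) s lams lam Q"
    using ex_eigenbasis[OF sym assms(3)] .
  then have det: "- det (hessian U \<sigma>) = lams * (\<Prod>i\<in>UNIV - {s}. lam i)"
    using det_eigenbasis by blast
  have coords: "(norm v)\<^sup>2 + (norm w)\<^sup>2 = (norm p)\<^sup>2 + (norm r)\<^sup>2 \<and>
          hamiltonian_quad U L \<sigma> (\<theta>, p, r)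
            = U \<sigma> - lams / 2 * (q $ s)\<^sup>2 + 1 / 2 * (\<Sum>i\<in>UNIV - {s}. lam i * (q $ i)\<^sup>2)
              + L / 2 * (norm v)\<^sup>2 + L / 2 * (norm w)\<^sup>2"
    if E: "eigenbasis (hessian U \<sigma>) s lams lam Q" and "(q, v, w) = eigen_coords Q \<sigma> (\<theta>, p, r)"
    for Q \<theta> p r q v w
  proof -
    have Q: "orthogonal_matrix Q" using E by (simp add: eigenbasis_iff)
    have x: "q = transpose Q *v (\<theta> - \<sigma>)" "v = transpose Q *v p" "w = transpose Q *v r"
      using that(2) by simp_all
    show ?thesis
      unfolding hamiltonian_quad_eq[OF C assms(2)] quadratic_form_eigenbasis[OF E] x
      by (simp add: norm_transpose_orthogonal[OF Q] add_divide_distrib)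
  qed
  have orth: "orthogonal_matrix Q" if "eigenbasis (hessian U \<sigma>) s lams lam Q" for Q
    using that by (simp add: eigenbasis_iff)
  show ?thesis
  proof (intro conjI allI impI)
    fix Q assume E: "eigenbasis (hessian U \<sigma>) s lams lam Q"
    show "orthogonal_matrix (lift_matrix Q)"
      by (rule orthogonal_lift_matrix[OF orth[OF E]])
    show "transpose (lift_matrix Q) ** drift_matrix U L \<gamma> \<sigma> ** lift_matrix Q
        = block_diag (triple L \<gamma> s lams lam)"
      by (rule drift_matrix_block_diag[OF C E])
    show "flat (eigen_coords Q \<sigma> (\<theta>, p, r))
        = transpose (lift_matrix Q) *v (flat (\<theta>, p, r) - flat (\<sigma>, 0, 0))" for \<theta> p r
      by (rule flat_eigen_coords)
    fix g :: "'n phase \<Rightarrow> real" and x assume g: "Ck 2 g"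
    show "laplace_r (g \<circ> eigen_coords Q \<sigma>) x = laplace_r g (eigen_coords Q \<sigma> x)"
      by (rule laplace_r_eigen_coords[OF g orth[OF E]])
    show "generator_lin U L \<gamma> \<epsilon> \<sigma> (g \<circ> eigen_coords Q \<sigma>) x
        = (\<Sum>i\<in>UNIV. triple_generator (triple L \<gamma> s lams lam i) (\<gamma> * \<epsilon> / L) i g
            (eigen_coords Q \<sigma> x))"
      by (rule generator_lin_eigen_coords[OF g E])
  next
    show "Re z < 0"
      if "i \<noteq> s" "eigval (map_matrix complex_of_real (normal_triple L \<gamma> (lam i))) z" for i z
      using normal_triple_stable assms that by blast
  qed (use ex det coords charpoly_saddle_triple ex1_saddle_cubic_root[OF assms(4,6,7)]
      saddle_positive_eigenvalue[OF assms(4,6,7)] in \<open>blast | simp\<close>)+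
qed

end
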